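(* Let $u$ be the exact solution of a hyperbolic PDE $u_t=\mathcal{F}(u,u_x,x,t)$, discretized on a uniform mesh with spacing $\Delta x$ by a Method of Lines scheme with spatial order $\alpha$ and a time-stepping method of order $\beta$, with time step $\Delta t$. Then the global truncation error (the norm over all mesh locations) at a fixed time horizon $T=N\Delta t$, reached after an integral number $N$ of time steps of magnitude $\Delta t$, satisfies $$\hat{\tau}_G = \mathcal{O}(\Delta x^{\alpha}) + \Delta t\,\mathcal{O}(\Delta x^{\alpha}) + \Delta t^2\,\mathcal{O}(\Delta x^{\alpha}) + \cdots + \Delta t^{\beta-1}\,\mathcal{O}(\Delta x^{\alpha}) + \mathcal{O}(\Delta t^{\beta}),$$ which, for $\Delta t\ll 1$ (that is, as $\Delta t\to 0$), reduces to $$\hat{\tau}_G = \mathcal{O}(\Delta x^{\alpha}) + \mathcal{O}(\Delta t^{\beta}).$$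
   Context: The PDE is a first-order one-dimensional PDE for $u(x,t)$, and $\mathcal{F}$ and $u$ are assumed sufficiently smooth for all Taylor expansions used. The mesh points are $x_j=j\Delta x$ and the time levels are $t^n=n\Delta t$. Write $u_j^n=u(x_j,t^n)$ and $(\mathcal{F}^{(k)})_j^n=(\partial^k u/\partial t^k)(x_j,t^n)$ for $k\ge 1$, these time derivatives being expressed through the PDE in terms of quantities at time level $t^n$, with $\mathcal{F}^{(1)}=\mathcal{F}$. The Taylor expansion of the exact solution is $u_j^{n+1}=u_j^n+\sum_{k\ge1}\frac{\Delta t^k}{k!}(\mathcal{F}^{(k)})_j^n$. Let $\hat{u}_j^{n+1}$ denote the numerical solution at $(x_j,t^{n+1})$ obtained from one time step of the scheme, starting from exact data (for a multistep method, exact data at $t^n$ and at the required earlier levels). A Method of Lines scheme with spatial discretization of order $\alpha\ge 1$ and time-stepping method of order $\beta\ge 1$ (positive integers) is one whose numerical solution has the form $$\hat{u}_j^{n+1}=u_j^n+\sum_{k\ge1}\frac{\Delta t^k}{k!}\left(\widehat{\mathcal{F}}^{(k)}+\mathcal{O}(\Delta x^{\alpha})\right)_j^n,$$ where the $\widehat{\mathcal{F}}^{(k)}$ are determined by the time-stepping method and $(\widehat{\mathcal{F}}^{(k)})_j^n=(\mathcal{F}^{(k)})_j^n$ for $k=1,\dots,\beta$. Both this series and the Taylor series of $u$ are understood as asymptotic expansions in $\Delta t$: truncating after any order $K$ leaves a remainder $\mathcal{O}(\Delta t^{K+1})$. All $\mathcal{O}$ terms are uniform in $j$ and in $n$ with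 $t^n\le T$. The local truncation error is $\hat{\tau}_j^{n+1}=u_j^{n+1}-\hat{u}_j^{n+1}$. The global truncation error at the time horizon $T=N\Delta t$ and location $x_j$, denoted $(\hat{\tau}_G)_j$, is the accumulation (sum) of the local truncation errors at $x_j$ over the $N=T/\Delta t$ time steps. The quantity $\hat{\tau}_G$ is the norm of $(\hat{\tau}_G)_j$ over all spatial locations $x_j$ (e.g. the maximum norm). *)

theory Defs
  imports "HOL-Analysis.Analysis" "HOL-Library.Landau_Symbols"
begin

text \<open>
  Conventions. The spatial domain is \<open>\<Omega> \<subseteq> \<real>\<close>, the exact solution is \<open>u x t\<close> on
  \<open>\<Omega> \<times> [0, T]\<close>. A discretization is a pair \<open>(\<Delta>x, N)\<close> with time step \<open>\<Delta>t = T / N\<close>, so that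
  \<open>T = N \<Delta>t\<close> with \<open>N\<close> integral, and \<open>\<Delta>t \<rightarrow> 0\<close> means \<open>N \<rightarrow> \<infinity>\<close>. A refinement process is a filter
  \<open>R\<close> on such pairs along which \<open>\<Delta>x \<rightarrow> 0+\<close> and \<open>N \<rightarrow> \<infinity>\<close>: either the two limits are independent,
  or they are coupled, as in \<open>\<Delta>t = c \<Delta>x\<close>.
\<close>

subsection \<open>The differential equation\<close>

text \<open>
  Derivatives are taken within \<open>[0, T]\<close> and \<open>\<Omega>\<close>, hence are one-sided at the end points.
\<close>

fun time_deriv :: "real \<Rightarrow> (real \<Rightarrow> real \<Rightarrow> real) \<Rightarrow> nat \<Rightarrow> real \<Rightarrow> real \<Rightarrow> real" where
  "time_deriv T u 0 x t = u x t"
| "time_deriv T u (Suc k) x t = vector_derivative (time_deriv T u k x) (at t within {0..T})"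

definition space_deriv :: "real set \<Rightarrow> (real \<Rightarrow> real \<Rightarrow> real) \<Rightarrow> real \<Rightarrow> real \<Rightarrow> real" where
  "space_deriv \<Omega> u x t = vector_derivative (\<lambda>y. u y t) (at x within \<Omega>)"

text \<open>
  The equation is scalar and of first order, with one space dimension and real \<open>F\<close>; its
  single characteristic speed is real, so hyperbolicity imposes no further condition.
\<close>

definition smooth_solution ::
  "(real \<Rightarrow> real \<Rightarrow> real \<Rightarrow> real \<Rightarrow> real) \<Rightarrow> real set \<Rightarrow> real \<Rightarrow> (real \<Rightarrow> real \<Rightarrow> real) \<Rightarrow> bool" where
  "smooth_solution F \<Omega> T u \<longleftrightarrow>
     (\<forall>x\<in>\<Omega>. \<forall>t\<in>{0..T}.
        (\<forall>k. time_deriv T u k x differentiable (at t within {0..T})) \<and>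
        (\<lambda>y. u y t) differentiable (at x within \<Omega>) \<and>
        time_deriv T u 1 x t = F (u x t) (space_deriv \<Omega> u x t) x t)"

subsection \<open>Mesh, uniform order terms and expansions in the time step\<close>

definition mesh :: "real set \<Rightarrow> real \<Rightarrow> int set" where
  "mesh \<Omega> \<Delta>x = {j. of_int j * \<Delta>x \<in> \<Omega>}"

definition at_node :: "(real \<Rightarrow> real \<Rightarrow> real) \<Rightarrow> real \<Rightarrow> real \<Rightarrow> nat \<Rightarrow> int \<Rightarrow> real" where
  "at_node f \<Delta>x \<Delta>t n j = f (of_int j * \<Delta>x) (real n * \<Delta>t)"

text \<open>
  \<open>f = O(g)\<close> along \<open>R\<close>, with one constant for all mesh locations and all steps
  \<open>t\<^sup>n \<rightarrow> t\<^sup>n\<^sup>+\<^sup>1\<close> inside \<open>[0, T]\<close>.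
\<close>

definition uniform_bigo ::
  "real set \<Rightarrow> (real \<times> nat) filter \<Rightarrow> (real \<Rightarrow> nat \<Rightarrow> nat \<Rightarrow> int \<Rightarrow> real) \<Rightarrow>
   (real \<Rightarrow> nat \<Rightarrow> real) \<Rightarrow> bool" where
  "uniform_bigo \<Omega> R f g \<longleftrightarrow>
     (\<exists>C. \<forall>\<^sub>F (\<Delta>x, N) in R. \<forall>n<N. \<forall>j\<in>mesh \<Omega> \<Delta>x. \<bar>f \<Delta>x N n j\<bar> \<le> C * \<bar>g \<Delta>x N\<bar>)"

text \<open>
  \<open>w \<sim> u\<^sub>j\<^sup>n + (\<Sum>k\<ge>1. \<Delta>t\<^sup>k / k! * c k)\<close> as an asymptotic expansion in \<open>\<Delta>t\<close>; here
  \<open>w \<Delta>x N n j\<close> and \<open>c k \<Delta>x N n j\<close> belong to the step from \<open>t\<^sup>n\<close> to \<open>t\<^sup>n\<^sup>+\<^sup>1\<close> at \<open>x\<^sub>j\<close>.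
\<close>

definition step_expansion ::
  "real set \<Rightarrow> real \<Rightarrow> (real \<times> nat) filter \<Rightarrow> (real \<Rightarrow> real \<Rightarrow> real) \<Rightarrow>
   (real \<Rightarrow> nat \<Rightarrow> nat \<Rightarrow> int \<Rightarrow> real) \<Rightarrow> (nat \<Rightarrow> real \<Rightarrow> nat \<Rightarrow> nat \<Rightarrow> int \<Rightarrow> real) \<Rightarrow> bool" where
  "step_expansion \<Omega> T R u w c \<longleftrightarrow>
     (\<forall>K. uniform_bigo \<Omega> R
        (\<lambda>\<Delta>x N n j. w \<Delta>x N n j -
           (at_node u \<Delta>x (T / N) n j + (\<Sum>k=1..K. (T / N) ^ k / fact k * c k \<Delta>x N n j)))
        (\<lambda>\<Delta>x N. (T / N) ^ (K + 1)))"

definition taylor_expansion ::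
  "real set \<Rightarrow> real \<Rightarrow> (real \<times> nat) filter \<Rightarrow> (real \<Rightarrow> real \<Rightarrow> real) \<Rightarrow> bool" where
  "taylor_expansion \<Omega> T R u \<longleftrightarrow>
     step_expansion \<Omega> T R u
       (\<lambda>\<Delta>x N n j. at_node u \<Delta>x (T / N) (Suc n) j)
       (\<lambda>k \<Delta>x N n j. at_node (time_deriv T u k) \<Delta>x (T / N) n j)"

subsection \<open>Method of Lines schemes\<close>

text \<open>
  A scheme maps \<open>\<Delta>x\<close>, \<open>\<Delta>t\<close> and the mesh functions at the levels \<open>t\<^sup>0, \<dots>, t\<^sup>n\<close> to the mesh
  function at \<open>t\<^sup>n\<^sup>+\<^sup>1\<close>. A one-step method looks at the last entry of the list only. A multistep
  method looks at several entries, and may use another formula while the list is short.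
\<close>

type_synonym scheme = "real \<Rightarrow> real \<Rightarrow> (int \<Rightarrow> real) list \<Rightarrow> int \<Rightarrow> real"

definition exact_data ::
  "real set \<Rightarrow> (real \<Rightarrow> real \<Rightarrow> real) \<Rightarrow> real \<Rightarrow> real \<Rightarrow> nat \<Rightarrow> (int \<Rightarrow> real) list" where
  "exact_data \<Omega> u \<Delta>x \<Delta>t n =
     map (\<lambda>m. restrict (at_node u \<Delta>x \<Delta>t m) (mesh \<Omega> \<Delta>x)) [0..<Suc n]"

text \<open>\<open>numerical \<Omega> u S \<Delta>x \<Delta>t n j\<close> is the value at \<open>(x\<^sub>j, t\<^sup>n\<^sup>+\<^sup>1)\<close>.\<close>

definition numerical ::
  "real set \<Rightarrow> (real \<Rightarrow> real \<Rightarrow> real) \<Rightarrow> scheme \<Rightarrow> real \<Rightarrow> real \<Rightarrow> nat \<Rightarrow> int \<Rightarrow> real" where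
  "numerical \<Omega> u S \<Delta>x \<Delta>t n j = S \<Delta>x \<Delta>t (exact_data \<Omega> u \<Delta>x \<Delta>t n) j"

text \<open>
  \<open>Fhat k n x t\<close> carries the step number \<open>n\<close> because the starting steps of a multistep method
  may be made with another formula of order \<open>\<beta>\<close>; \<open>e k\<close> is the term \<open>O(\<Delta>x\<^sup>\<alpha>)\<close> in the
  coefficient of \<open>\<Delta>t\<^sup>k / k!\<close>.
\<close>

definition mol_scheme ::
  "real set \<Rightarrow> real \<Rightarrow> (real \<times> nat) filter \<Rightarrow> (real \<Rightarrow> real \<Rightarrow> real) \<Rightarrow> nat \<Rightarrow> nat \<Rightarrow> scheme \<Rightarrow> bool" where
  "mol_scheme \<Omega> T R u \<alpha> \<beta> S \<longleftrightarrow>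
     (\<exists>Fhat e.
        (\<forall>k\<in>{1..\<beta>}. \<forall>n. \<forall>x\<in>\<Omega>. \<forall>t\<in>{0..T}. Fhat k n x t = time_deriv T u k x t) \<and>
        (\<forall>k\<ge>1. uniform_bigo \<Omega> R (e k) (\<lambda>\<Delta>x N. \<Delta>x ^ \<alpha>)) \<and>
        step_expansion \<Omega> T R u
          (\<lambda>\<Delta>x N n j. numerical \<Omega> u S \<Delta>x (T / N) n j)
          (\<lambda>k \<Delta>x N n j. at_node (Fhat k n) \<Delta>x (T / N) n j + e k \<Delta>x N n j))"

subsection \<open>Truncation errors\<close>

text \<open>\<open>local_error \<Omega> u S \<Delta>x \<Delta>t n j\<close> is the error at \<open>(x\<^sub>j, t\<^sup>n\<^sup>+\<^sup>1)\<close>.\<close>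

definition local_error ::
  "real set \<Rightarrow> (real \<Rightarrow> real \<Rightarrow> real) \<Rightarrow> scheme \<Rightarrow> real \<Rightarrow> real \<Rightarrow> nat \<Rightarrow> int \<Rightarrow> real" where
  "local_error \<Omega> u S \<Delta>x \<Delta>t n j = at_node u \<Delta>x \<Delta>t (Suc n) j - numerical \<Omega> u S \<Delta>x \<Delta>t n j"

definition global_error ::
  "real set \<Rightarrow> real \<Rightarrow> (real \<Rightarrow> real \<Rightarrow> real) \<Rightarrow> scheme \<Rightarrow> real \<Rightarrow> nat \<Rightarrow> int \<Rightarrow> real" where
  "global_error \<Omega> T u S \<Delta>x N j = (\<Sum>n<N. local_error \<Omega> u S \<Delta>x (T / N) n j)"

subsection \<open>Norms over all mesh locations\<close>

text \<open>The inserted \<open>0\<close> matters only for an empty mesh.\<close>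

definition max_norm :: "int set \<Rightarrow> (int \<Rightarrow> real) \<Rightarrow> real" where
  "max_norm J v = Sup (insert 0 ((\<lambda>j. \<bar>v j\<bar>) ` J))"

definition norm_on_mesh :: "int set \<Rightarrow> ((int \<Rightarrow> real) \<Rightarrow> real) \<Rightarrow> bool" where
  "norm_on_mesh J p \<longleftrightarrow>
     (\<forall>v. bounded (v ` J) \<longrightarrow>
        0 \<le> p v \<and> (p v = 0 \<longleftrightarrow> (\<forall>j\<in>J. v j = 0)) \<and>
        (\<forall>c. p (\<lambda>j. c * v j) = \<bar>c\<bar> * p v) \<and>
        (\<forall>w. bounded (w ` J) \<longrightarrow> p (\<lambda>j. v j + w j) \<le> p v + p w))"

text \<open>
  One norm per mesh width, dominated by the maximum norm uniformly as \<open>\<Delta>x \<rightarrow> 0\<close>. The maximum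
  norm qualifies, and so do the discrete \<open>L\<^sup>p\<close> norms \<open>(\<Delta>x \<Sum>\<^sub>j \<bar>v\<^sub>j\<bar>\<^sup>p)\<^sup>1\<^sup>/\<^sup>p\<close> on bounded \<open>\<Omega>\<close>. Without
  the factor \<open>\<Delta>x\<close> the latter grow with the number of mesh points, and no estimate uniform in
  \<open>\<Delta>x\<close> can hold for them.
\<close>

definition mesh_norm :: "real set \<Rightarrow> (real \<Rightarrow> (int \<Rightarrow> real) \<Rightarrow> real) \<Rightarrow> bool" where
  "mesh_norm \<Omega> \<nu> \<longleftrightarrow>
     (\<forall>\<Delta>x>0. norm_on_mesh (mesh \<Omega> \<Delta>x) (\<nu> \<Delta>x)) \<and>
     (\<exists>C. \<forall>\<^sub>F \<Delta>x in at_right 0. \<forall>v. bounded (v ` mesh \<Omega> \<Delta>x) \<longrightarrow>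
        \<nu> \<Delta>x v \<le> C * max_norm (mesh \<Omega> \<Delta>x) v)"

lemma bdd_above_mesh_abs:
  fixes v :: "int \<Rightarrow> real"
  assumes "bounded (v ` J)"
  shows "bdd_above (insert 0 ((\<lambda>j. \<bar>v j\<bar>) ` J))"
proof -
  obtain B where "\<forall>j\<in>J. \<bar>v j\<bar> \<le> B"
    using assms by (auto simp: bounded_iff)
  then show ?thesis
    by (auto intro!: bdd_aboveI[of _ B])
qed

lemma max_norm_le:
  assumes "0 \<le> B" "\<And>j. j \<in> J \<Longrightarrow> \<bar>v j\<bar> \<le> B"
  shows "max_norm J v \<le> B"
  unfolding max_norm_def by (rule cSup_least) (use assms in auto)

lemma max_norm_ge_0: "bounded (v ` J) \<Longrightarrow> 0 \<le> max_norm J v"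
  unfolding max_norm_def by (rule cSup_upper[OF _ bdd_above_mesh_abs]) simp_all

lemma max_norm_ge: "bounded (v ` J) \<Longrightarrow> j \<in> J \<Longrightarrow> \<bar>v j\<bar> \<le> max_norm J v"
  unfolding max_norm_def by (rule cSup_upper[OF _ bdd_above_mesh_abs]) simp_all

lemma norm_on_mesh_max_norm: "norm_on_mesh J (max_norm J)"
  unfolding norm_on_mesh_def
proof (intro allI impI conjI)
  fix v :: "int \<Rightarrow> real" and c :: real
  assume v: "bounded (v ` J)"
  show "0 \<le> max_norm J v"
    using v by (rule max_norm_ge_0)
  show "max_norm J v = 0 \<longleftrightarrow> (\<forall>j\<in>J. v j = 0)"
  proof
    assume "max_norm J v = 0"
    then show "\<forall>j\<in>J. v j = 0"
      using max_norm_ge[OF v] by fastforce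
  next
    assume "\<forall>j\<in>J. v j = 0"
    then have "max_norm J v \<le> 0"
      by (intro max_norm_le) auto
    then show "max_norm J v = 0"
      using max_norm_ge_0[OF v] by simp
  qed
  have scale: "max_norm J (\<lambda>j. d * w j) \<le> \<bar>d\<bar> * max_norm J w"
    if "bounded (w ` J)" for d :: real and w
    using max_norm_ge_0[OF that] max_norm_ge[OF that]
    by (intro max_norm_le) (auto simp: abs_mult mult_left_mono)
  have cv: "bounded ((\<lambda>j. c * v j) ` J)"
    using bounded_scaling[OF v, of c] by (simp add: image_image)
  show "max_norm J (\<lambda>j. c * v j) = \<bar>c\<bar> * max_norm J v"
  proof (cases "c = 0")
    case True
    then show ?thesis
      using scale[OF v, of 0] max_norm_ge_0[OF cv] by simp
  next
    case False
    then have "max_norm J v \<le> \<bar>1 / c\<bar> * max_norm J (\<lambda>j. c * v j)"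
      using scale[OF cv, of "1 / c"] by simp
    then have "\<bar>c\<bar> * max_norm J v \<le> max_norm J (\<lambda>j. c * v j)"
      using False by (simp add: field_simps)
    then show ?thesis
      using scale[OF v, of c] by simp
  qed
next
  fix v w :: "int \<Rightarrow> real"
  assume v: "bounded (v ` J)" and w: "bounded (w ` J)"
  show "max_norm J (\<lambda>j. v j + w j) \<le> max_norm J v + max_norm J w"
  proof (rule max_norm_le)
    show "0 \<le> max_norm J v + max_norm J w"
      using max_norm_ge_0[OF v] max_norm_ge_0[OF w] by simp
    show "\<bar>v j + w j\<bar> \<le> max_norm J v + max_norm J w" if "j \<in> J" for j
      using max_norm_ge[OF v that] max_norm_ge[OF w that] by linarith
  qed
qed

lemma mesh_norm_max_norm: "mesh_norm \<Omega> (\<lambda>\<Delta>x. max_norm (mesh \<Omega> \<Delta>x))"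
  unfolding mesh_norm_def
  by (auto simp: norm_on_mesh_max_norm intro!: exI[of _ 1] always_eventually)

end

theory Submission
  imports Defs
begin

text \<open>
  Write \<open>\<Delta>t = T / N\<close>. Expand the exact and the numerical solution in \<open>\<Delta>t\<close> up to order \<open>\<beta>\<close>. Both
  expansions start from the same \<open>u\<^sub>j\<^sup>n\<close>, and the time-stepping method reproduces the first \<open>\<beta>\<close>
  time derivatives, so the subtraction leaves only the spatial errors
  \<open>\<Delta>t\<^sup>k / k! * O(\<Delta>x\<^sup>\<alpha>)\<close> with \<open>1 \<le> k \<le> \<beta>\<close> and a remainder \<open>O(\<Delta>t\<^sup>\<beta>\<^sup>+\<^sup>1)\<close>. The local error is
  therefore \<open>\<Delta>t * O(W)\<close> with \<open>W = \<Delta>x\<^sup>\<alpha> + \<Delta>t \<Delta>x\<^sup>\<alpha> + \<dots> + \<Delta>t\<^sup>\<beta>\<^sup>-\<^sup>1 \<Delta>x\<^sup>\<alpha> + \<Delta>t\<^sup>\<beta>\<close>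
  (\<open>local_error_bigo\<close>). Adding up \<open>N\<close> steps costs a factor \<open>N = T / \<Delta>t\<close>, which cancels the
  \<open>\<Delta>t\<close> in front (\<open>sum_over_steps_bound\<close>), and since every bound is uniform over the mesh it
  passes to any norm dominated by the maximum norm (\<open>mesh_norm_bigo\<close>).

  A norm is not additive, so the decomposition asserted by the theorem cannot be obtained by
  taking norms of the separate pointwise contributions. It comes instead from the bound itself:
  a quantity that is \<open>O(W)\<close> can be distributed over the summands of \<open>W\<close> in proportion to their
  sizes (\<open>bigo_weighted_sum_split\<close>). The short form follows because each power \<open>\<Delta>t\<^sup>k\<close> is bounded.
\<close>

section \<open>Calculus of uniform order terms\<close>

lemma uniform_bigo_nonneg_constE:
  assumes "uniform_bigo \<Omega> R f g"
  obtains C where "C \<ge> 0"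
    "\<forall>\<^sub>F (\<Delta>x, N) in R. \<forall>n<N. \<forall>j\<in>mesh \<Omega> \<Delta>x. \<bar>f \<Delta>x N n j\<bar> \<le> C * \<bar>g \<Delta>x N\<bar>"
proof -
  obtain C where C: "\<forall>\<^sub>F (\<Delta>x, N) in R. \<forall>n<N. \<forall>j\<in>mesh \<Omega> \<Delta>x. \<bar>f \<Delta>x N n j\<bar> \<le> C * \<bar>g \<Delta>x N\<bar>"
    using assms unfolding uniform_bigo_def by blast
  have weaken: "x \<le> \<bar>C\<bar> * \<bar>y\<bar>" if "x \<le> C * \<bar>y\<bar>" for x y :: real
    using that mult_right_mono[OF abs_ge_self[of C], of "\<bar>y\<bar>"] by linarith
  then have "\<forall>\<^sub>F (\<Delta>x, N) in R. \<forall>n<N. \<forall>j\<in>mesh \<Omega> \<Delta>x. \<bar>f \<Delta>x N n j\<bar> \<le> \<bar>C\<bar> * \<bar>g \<Delta>x N\<bar>"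
    by (intro eventually_mono[OF C]) (auto intro: weaken)
  then show ?thesis
    by (intro that[of "\<bar>C\<bar>"]) auto
qed

lemma uniform_bigo_mono:
  assumes f: "uniform_bigo \<Omega> R f g"
    and le: "\<forall>\<^sub>F (\<Delta>x, N) in R. \<bar>g \<Delta>x N\<bar> \<le> \<bar>h \<Delta>x N\<bar>"
  shows "uniform_bigo \<Omega> R f h"
proof -
  obtain C where "C \<ge> 0"
    and C: "\<forall>\<^sub>F (\<Delta>x, N) in R. \<forall>n<N. \<forall>j\<in>mesh \<Omega> \<Delta>x. \<bar>f \<Delta>x N n j\<bar> \<le> C * \<bar>g \<Delta>x N\<bar>"
    using f by (rule uniform_bigo_nonneg_constE)
  have "\<forall>\<^sub>F (\<Delta>x, N) in R. \<forall>n<N. \<forall>j\<in>mesh \<Omega> \<Delta>x. \<bar>f \<Delta>x N n j\<bar> \<le> C * \<bar>h \<Delta>x N\<bar>"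
    using C le
  proof eventually_elim
    case (elim p)
    obtain \<Delta>x N where [simp]: "p = (\<Delta>x, N)"
      by (cases p)
    have "C * \<bar>g \<Delta>x N\<bar> \<le> C * \<bar>h \<Delta>x N\<bar>"
      using elim \<open>C \<ge> 0\<close> by (intro mult_left_mono) auto
    then show ?case
      using elim by fastforce
  qed
  then show ?thesis
    unfolding uniform_bigo_def by blast
qed

lemma uniform_bigo_cong:
  assumes "uniform_bigo \<Omega> R f g"
    and "\<And>\<Delta>x N n j. n < N \<Longrightarrow> j \<in> mesh \<Omega> \<Delta>x \<Longrightarrow> f \<Delta>x N n j = f' \<Delta>x N n j"
  shows "uniform_bigo \<Omega> R f' g"
  using assms(1) unfolding uniform_bigo_def by (simp add: assms(2) case_prod_unfold cong: ball_cong)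

lemma uniform_bigo_zero: "uniform_bigo \<Omega> R (\<lambda>\<Delta>x N n j. 0) g"
  unfolding uniform_bigo_def by (rule exI[of _ 0]) (simp add: case_prod_unfold)

lemma uniform_bigo_mult:
  assumes "uniform_bigo \<Omega> R f g"
  shows "uniform_bigo \<Omega> R (\<lambda>\<Delta>x N n j. c \<Delta>x N * f \<Delta>x N n j) (\<lambda>\<Delta>x N. c \<Delta>x N * g \<Delta>x N)"
proof -
  obtain C where C: "\<forall>\<^sub>F (\<Delta>x, N) in R. \<forall>n<N. \<forall>j\<in>mesh \<Omega> \<Delta>x. \<bar>f \<Delta>x N n j\<bar> \<le> C * \<bar>g \<Delta>x N\<bar>"
    using assms unfolding uniform_bigo_def by blast
  have scale: "\<bar>c * x\<bar> \<le> C * \<bar>c * y\<bar>" if "\<bar>x\<bar> \<le> C * \<bar>y\<bar>" for c x y :: real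
    using mult_left_mono[OF that, of "\<bar>c\<bar>"] by (simp add: abs_mult mult_ac)
  show ?thesis
    unfolding uniform_bigo_def by (rule exI[of _ C], rule eventually_mono[OF C]) (auto intro: scale)
qed

lemma uniform_bigo_add:
  assumes f: "uniform_bigo \<Omega> R f g" and f': "uniform_bigo \<Omega> R f' g"
  shows "uniform_bigo \<Omega> R (\<lambda>\<Delta>x N n j. f \<Delta>x N n j + f' \<Delta>x N n j) g"
proof -
  obtain C where C: "\<forall>\<^sub>F (\<Delta>x, N) in R. \<forall>n<N. \<forall>j\<in>mesh \<Omega> \<Delta>x. \<bar>f \<Delta>x N n j\<bar> \<le> C * \<bar>g \<Delta>x N\<bar>"
    using f unfolding uniform_bigo_def by blast
  obtain C' where C': "\<forall>\<^sub>F (\<Delta>x, N) in R. \<forall>n<N. \<forall>j\<in>mesh \<Omega> \<Delta>x. \<bar>f' \<Delta>x N n j\<bar> \<le> C' * \<bar>g \<Delta>x N\<bar>"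
    using f' unfolding uniform_bigo_def by blast
  have add: "\<bar>x + y\<bar> \<le> (C + C') * z" if "\<bar>x\<bar> \<le> C * z" "\<bar>y\<bar> \<le> C' * z" for x y z :: real
    using that by (simp add: distrib_right)
  have "\<forall>\<^sub>F (\<Delta>x, N) in R. \<forall>n<N. \<forall>j\<in>mesh \<Omega> \<Delta>x.
          \<bar>f \<Delta>x N n j + f' \<Delta>x N n j\<bar> \<le> (C + C') * \<bar>g \<Delta>x N\<bar>"
    using C C' by eventually_elim (auto intro: add)
  then show ?thesis
    unfolding uniform_bigo_def by blast
qed

lemma uniform_bigo_diff:
  assumes "uniform_bigo \<Omega> R f g" and "uniform_bigo \<Omega> R f' g"
  shows "uniform_bigo \<Omega> R (\<lambda>\<Delta>x N n j. f \<Delta>x N n j - f' \<Delta>x N n j) g"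
proof -
  have "uniform_bigo \<Omega> R (\<lambda>\<Delta>x N n j. - f' \<Delta>x N n j) g"
    using assms(2) by (simp add: uniform_bigo_def)
  from uniform_bigo_add[OF assms(1) this] show ?thesis
    by simp
qed

lemma uniform_bigo_sum:
  assumes "finite I" and "\<And>i. i \<in> I \<Longrightarrow> uniform_bigo \<Omega> R (f i) g"
  shows "uniform_bigo \<Omega> R (\<lambda>\<Delta>x N n j. \<Sum>i\<in>I. f i \<Delta>x N n j) g"
  using assms by (induction I rule: finite_induct) (simp_all add: uniform_bigo_zero uniform_bigo_add)

section \<open>Refinement and the error scale\<close>

lemma eventually_refined:
  assumes "R \<le> at_right 0 \<times>\<^sub>F sequentially"
  shows "\<forall>\<^sub>F (\<Delta>x, N) in R. (0::real) < \<Delta>x \<and> 0 < N"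
proof -
  have "\<forall>\<^sub>F p in at_right (0::real) \<times>\<^sub>F sequentially. 0 < fst p \<and> 0 < snd p"
    by (intro eventually_prodI eventually_at_right_less eventually_gt_at_top)
  then show ?thesis
    by (intro filter_leD[OF assms]) (simp add: case_prod_unfold)
qed

text \<open>
  The sum \<open>W\<close> of the sizes of all terms in the long form of the estimate.
\<close>

definition error_scale :: "real \<Rightarrow> nat \<Rightarrow> nat \<Rightarrow> real \<Rightarrow> nat \<Rightarrow> real" where
  "error_scale T \<alpha> \<beta> \<Delta>x N = (\<Sum>k<\<beta>. (T / N) ^ k * \<Delta>x ^ \<alpha>) + (T / N) ^ \<beta>"

lemma space_term_le_error_scale:
  assumes "T \<ge> 0" "\<Delta>x \<ge> 0" "k < \<beta>"
  shows "(T / N) ^ k * \<Delta>x ^ \<alpha> \<le> error_scale T \<alpha> \<beta> \<Delta>x N"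
proof -
  have "(T / N) ^ k * \<Delta>x ^ \<alpha> \<le> (\<Sum>k<\<beta>. (T / N) ^ k * \<Delta>x ^ \<alpha>)"
    using assms by (intro member_le_sum) auto
  then show ?thesis
    using assms(1) unfolding error_scale_def by (simp add: add_increasing2)
qed

lemma time_term_le_error_scale:
  assumes "T \<ge> 0" "\<Delta>x \<ge> 0"
  shows "(T / N) ^ \<beta> \<le> error_scale T \<alpha> \<beta> \<Delta>x N"
  using assms unfolding error_scale_def by (simp add: sum_nonneg)

section \<open>The local error\<close>

text \<open>
  Two expansions about the same data share the term \<open>u\<^sub>j\<^sup>n\<close>, so their difference is governed by the
  differences of the coefficients.
\<close>

lemma step_expansion_diff:
  assumes "step_expansion \<Omega> T R u v a" and "step_expansion \<Omega> T R u w b"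
  shows "uniform_bigo \<Omega> R
    (\<lambda>\<Delta>x N n j. v \<Delta>x N n j - w \<Delta>x N n j
       - (\<Sum>k=1..K. (T / N) ^ k / fact k * (a k \<Delta>x N n j - b k \<Delta>x N n j)))
    (\<lambda>\<Delta>x N. (T / N) ^ (K + 1))"
proof (rule uniform_bigo_cong)
  show "uniform_bigo \<Omega> R
    (\<lambda>\<Delta>x N n j.
       (v \<Delta>x N n j - (at_node u \<Delta>x (T / N) n j + (\<Sum>k=1..K. (T / N) ^ k / fact k * a k \<Delta>x N n j)))
     - (w \<Delta>x N n j - (at_node u \<Delta>x (T / N) n j + (\<Sum>k=1..K. (T / N) ^ k / fact k * b k \<Delta>x N n j))))
    (\<lambda>\<Delta>x N. (T / N) ^ (K + 1))"
    using assms unfolding step_expansion_def by - (rule uniform_bigo_diff; blast)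
qed (simp add: right_diff_distrib sum_subtractf)

text \<open>
  The order conditions cancel the time derivatives up to order \<open>\<beta>\<close>. Each surviving spatial term has
  \<open>k \<ge> 1\<close> and the remainder has the power \<open>\<beta> + 1\<close>, so one factor \<open>\<Delta>t\<close> can be taken out of every
  contribution; this is the factor that the summation over the time steps will consume.
\<close>

lemma local_error_bigo:
  assumes T: "T > 0" and R: "R \<le> at_right 0 \<times>\<^sub>F sequentially"
    and taylor: "taylor_expansion \<Omega> T R u"
    and mol: "mol_scheme \<Omega> T R u \<alpha> \<beta> S"
  shows "uniform_bigo \<Omega> R (\<lambda>\<Delta>x N n j. local_error \<Omega> u S \<Delta>x (T / N) n j)
           (\<lambda>\<Delta>x N. T / N * error_scale T \<alpha> \<beta> \<Delta>x N)"
proof -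
  let ?D = "\<lambda>k \<Delta>x N n j. at_node (time_deriv T u k) \<Delta>x (T / real N) n j"
  let ?W = "\<lambda>\<Delta>x N. T / real N * error_scale T \<alpha> \<beta> \<Delta>x N"
  obtain Fhat e where
    order: "\<And>k n x t. k \<in> {1..\<beta>} \<Longrightarrow> x \<in> \<Omega> \<Longrightarrow> t \<in> {0..T} \<Longrightarrow> Fhat k n x t = time_deriv T u k x t"
    and e: "\<And>k. k \<ge> 1 \<Longrightarrow> uniform_bigo \<Omega> R (e k) (\<lambda>\<Delta>x N. \<Delta>x ^ \<alpha>)"
    and num: "step_expansion \<Omega> T R u
          (\<lambda>\<Delta>x N n j. numerical \<Omega> u S \<Delta>x (T / N) n j)
          (\<lambda>k \<Delta>x N n j. at_node (Fhat k n) \<Delta>x (T / N) n j + e k \<Delta>x N n j)"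
    using mol unfolding mol_scheme_def by blast
  have same: "at_node (Fhat k n) \<Delta>x (T / real N) n j = ?D k \<Delta>x N n j"
    if "k \<in> {1..\<beta>}" "n < N" "j \<in> mesh \<Omega> \<Delta>x" for k n j \<Delta>x N
  proof -
    have "real n * T \<le> real N * T"
      using that(2) T by (intro mult_right_mono) auto
    then have "real n * (T / real N) \<in> {0..T}"
      using that(2) T by (simp add: field_simps)
    then show ?thesis
      using that(3) order[OF that(1)] by (simp add: at_node_def mesh_def)
  qed

  have "uniform_bigo \<Omega> R
    (\<lambda>\<Delta>x N n j. local_error \<Omega> u S \<Delta>x (T / N) n j
       - (\<Sum>k=1..\<beta>. (T / N) ^ k / fact k
            * (?D k \<Delta>x N n j - (at_node (Fhat k n) \<Delta>x (T / N) n j + e k \<Delta>x N n j))))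
    (\<lambda>\<Delta>x N. (T / N) ^ (\<beta> + 1))"
    unfolding local_error_def
    using taylor num unfolding taylor_expansion_def by (rule step_expansion_diff)
  then have "uniform_bigo \<Omega> R
    (\<lambda>\<Delta>x N n j. local_error \<Omega> u S \<Delta>x (T / N) n j + (\<Sum>k=1..\<beta>. (T / N) ^ k / fact k * e k \<Delta>x N n j))
    (\<lambda>\<Delta>x N. (T / N) ^ (\<beta> + 1))"
  proof (rule uniform_bigo_cong, goal_cases)
    case (1 \<Delta>x N n j)
    then have "(\<Sum>k=1..\<beta>. (T / N) ^ k / fact k
            * (?D k \<Delta>x N n j - (at_node (Fhat k n) \<Delta>x (T / N) n j + e k \<Delta>x N n j)))
       = (\<Sum>k=1..\<beta>. - ((T / N) ^ k / fact k * e k \<Delta>x N n j))"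
      by (intro sum.cong refl) (simp add: same)
    then show ?case
      by (simp add: sum_negf)
  qed
  then have remainder: "uniform_bigo \<Omega> R
    (\<lambda>\<Delta>x N n j. local_error \<Omega> u S \<Delta>x (T / N) n j + (\<Sum>k=1..\<beta>. (T / N) ^ k / fact k * e k \<Delta>x N n j))
    ?W"
  proof (rule uniform_bigo_mono)
    show "\<forall>\<^sub>F (\<Delta>x, N) in R. \<bar>(T / real N) ^ (\<beta> + 1)\<bar> \<le> \<bar>?W \<Delta>x N\<bar>"
      using eventually_refined[OF R]
    proof eventually_elim
      case (elim p)
      obtain \<Delta>x N where [simp]: "p = (\<Delta>x, N)"
        by (cases p)
      have "T / N * (T / N) ^ \<beta> \<le> ?W \<Delta>x N"
        using elim T by (intro mult_left_mono time_term_le_error_scale) auto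
      moreover have "0 \<le> T / N * (T / N) ^ \<beta>"
        using T by simp
      ultimately have "\<bar>T / N * (T / N) ^ \<beta>\<bar> \<le> \<bar>?W \<Delta>x N\<bar>"
        by linarith
      then show ?case
        by simp
    qed
  qed

  have "uniform_bigo \<Omega> R (\<lambda>\<Delta>x N n j. (T / N) ^ k / fact k * e k \<Delta>x N n j) ?W"
    if k: "k \<in> {1..\<beta>}" for k
  proof -
    have le: "\<forall>\<^sub>F (\<Delta>x, N) in R. \<bar>(T / real N) ^ k / fact k * \<Delta>x ^ \<alpha>\<bar> \<le> \<bar>?W \<Delta>x N\<bar>"
      using eventually_refined[OF R]
    proof eventually_elim
      case (elim p)
      obtain \<Delta>x N where [simp]: "p = (\<Delta>x, N)"
        by (cases p)
      have pos: "0 < \<Delta>x" "0 < N"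
        using elim by auto
      obtain i where i: "k = Suc i" "i < \<beta>"
        using k by (cases k) auto
      have "(T / N) ^ k / fact k * \<Delta>x ^ \<alpha> \<le> (T / N) ^ k / 1 * \<Delta>x ^ \<alpha>"
        using pos T by (intro mult_right_mono divide_left_mono fact_ge_1) auto
      also have "\<dots> = T / N * ((T / N) ^ i * \<Delta>x ^ \<alpha>)"
        by (simp add: i)
      also have "\<dots> \<le> ?W \<Delta>x N"
        using pos T i by (intro mult_left_mono space_term_le_error_scale) auto
      finally have "(T / N) ^ k / fact k * \<Delta>x ^ \<alpha> \<le> ?W \<Delta>x N" .
      moreover have "0 \<le> (T / N) ^ k / fact k * \<Delta>x ^ \<alpha>"
        using pos T by simp
      ultimately have "\<bar>(T / N) ^ k / fact k * \<Delta>x ^ \<alpha>\<bar> \<le> \<bar>?W \<Delta>x N\<bar>"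
        by linarith
      then show ?case
        by simp
    qed
    have "uniform_bigo \<Omega> R (\<lambda>\<Delta>x N n j. (T / N) ^ k / fact k * e k \<Delta>x N n j)
        (\<lambda>\<Delta>x N. (T / N) ^ k / fact k * \<Delta>x ^ \<alpha>)"
      using k e by (intro uniform_bigo_mult) simp
    then show ?thesis
      using le by (rule uniform_bigo_mono)
  qed
  then have "uniform_bigo \<Omega> R (\<lambda>\<Delta>x N n j. \<Sum>k=1..\<beta>. (T / N) ^ k / fact k * e k \<Delta>x N n j) ?W"
    by (intro uniform_bigo_sum) auto
  from uniform_bigo_diff[OF remainder this] show ?thesis
    by simp
qed

section \<open>Accumulation over the time steps and passage to the norm\<close>

text \<open>
  Every step contributes at most \<open>C \<Delta>t g\<close>, and \<open>N \<Delta>t = T\<close>: exactly one power of \<open>\<Delta>t\<close> is lost.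
\<close>

lemma sum_over_steps_bound:
  assumes T: "T \<ge> 0" and f: "uniform_bigo \<Omega> R f (\<lambda>\<Delta>x N. T / N * g \<Delta>x N)"
  shows "\<exists>C. \<forall>\<^sub>F (\<Delta>x, N) in R. \<forall>j\<in>mesh \<Omega> \<Delta>x. \<bar>\<Sum>n<N. f \<Delta>x N n j\<bar> \<le> C * \<bar>g \<Delta>x N\<bar>"
proof -
  obtain C where "C \<ge> 0"
    and C: "\<forall>\<^sub>F (\<Delta>x, N) in R. \<forall>n<N. \<forall>j\<in>mesh \<Omega> \<Delta>x. \<bar>f \<Delta>x N n j\<bar> \<le> C * \<bar>T / N * g \<Delta>x N\<bar>"
    using f by (rule uniform_bigo_nonneg_constE)
  have accumulate: "\<bar>\<Sum>n<N. a n\<bar> \<le> C * T * \<bar>y\<bar>"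
    if "\<And>n. n < N \<Longrightarrow> \<bar>a n\<bar> \<le> C * \<bar>T / real N * y\<bar>" for a y and N :: nat
  proof -
    have "\<bar>\<Sum>n<N. a n\<bar> \<le> (\<Sum>n<N. C * \<bar>T / real N * y\<bar>)"
      using that by (intro order_trans[OF sum_abs] sum_mono) auto
    also have "\<dots> = real N * (C * (T / real N * \<bar>y\<bar>))"
      using T by (simp add: abs_mult)
    also have "\<dots> \<le> C * T * \<bar>y\<bar>"
      using T \<open>C \<ge> 0\<close> by (cases "N = 0") auto
    finally show ?thesis .
  qed
  have "\<forall>\<^sub>F (\<Delta>x, N) in R. \<forall>j\<in>mesh \<Omega> \<Delta>x. \<bar>\<Sum>n<N. f \<Delta>x N n j\<bar> \<le> C * T * \<bar>g \<Delta>x N\<bar>"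
    by (rule eventually_mono[OF C]) (auto intro: accumulate)
  then show ?thesis
    by blast
qed

text \<open>
  The axioms of a mesh norm speak about bounded mesh functions only, and the mesh may be infinite;
  the pointwise bound is what makes \<open>v\<close> bounded, besides controlling its maximum norm.
\<close>

lemma mesh_norm_bigo:
  assumes \<nu>: "mesh_norm \<Omega> \<nu>" and R: "R \<le> at_right 0 \<times>\<^sub>F sequentially"
    and v: "\<exists>C. \<forall>\<^sub>F (\<Delta>x, N) in R. \<forall>j\<in>mesh \<Omega> \<Delta>x. \<bar>v \<Delta>x N j\<bar> \<le> C * \<bar>g \<Delta>x N\<bar>"
  shows "(\<lambda>(\<Delta>x, N). \<nu> \<Delta>x (v \<Delta>x N)) \<in> O[R](\<lambda>(\<Delta>x, N). g \<Delta>x N)"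
proof -
  obtain C where C: "\<forall>\<^sub>F (\<Delta>x, N) in R. \<forall>j\<in>mesh \<Omega> \<Delta>x. \<bar>v \<Delta>x N j\<bar> \<le> C * \<bar>g \<Delta>x N\<bar>"
    using v by blast
  obtain D where "\<forall>\<^sub>F \<Delta>x in at_right 0. \<forall>w. bounded (w ` mesh \<Omega> \<Delta>x) \<longrightarrow>
      \<nu> \<Delta>x w \<le> D * max_norm (mesh \<Omega> \<Delta>x) w"
    using \<nu> unfolding mesh_norm_def by blast
  then have "\<forall>\<^sub>F (\<Delta>x, N) in at_right 0 \<times>\<^sub>F sequentially. \<forall>w. bounded (w ` mesh \<Omega> \<Delta>x) \<longrightarrow>
      \<nu> \<Delta>x w \<le> D * max_norm (mesh \<Omega> \<Delta>x) w"
    by (subst eventually_prod1) simp_all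
  then have D: "\<forall>\<^sub>F (\<Delta>x, N) in R. \<forall>w. bounded (w ` mesh \<Omega> \<Delta>x) \<longrightarrow>
      \<nu> \<Delta>x w \<le> D * max_norm (mesh \<Omega> \<Delta>x) w"
    by (rule filter_leD[OF R])
  have "\<forall>\<^sub>F (\<Delta>x, N) in R. norm (\<nu> \<Delta>x (v \<Delta>x N)) \<le> \<bar>D\<bar> * \<bar>C\<bar> * norm (g \<Delta>x N)"
    using eventually_refined[OF R] C D
  proof eventually_elim
    case (elim p)
    obtain \<Delta>x N where [simp]: "p = (\<Delta>x, N)"
      by (cases p)
    let ?J = "mesh \<Omega> \<Delta>x" and ?v = "v \<Delta>x N"
    have le: "\<bar>?v j\<bar> \<le> \<bar>C\<bar> * \<bar>g \<Delta>x N\<bar>" if "j \<in> ?J" for j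
    proof -
      have "\<bar>?v j\<bar> \<le> C * \<bar>g \<Delta>x N\<bar>"
        using elim that by auto
      also have "\<dots> \<le> \<bar>C\<bar> * \<bar>g \<Delta>x N\<bar>"
        by (intro mult_right_mono) auto
      finally show ?thesis .
    qed
    then have bdd: "bounded (?v ` ?J)"
      by (auto simp: bounded_iff)
    have "norm_on_mesh ?J (\<nu> \<Delta>x)"
      using \<nu> elim unfolding mesh_norm_def by auto
    then have "0 \<le> \<nu> \<Delta>x ?v"
      using bdd unfolding norm_on_mesh_def by blast
    moreover have "\<nu> \<Delta>x ?v \<le> D * max_norm ?J ?v"
      using elim bdd by auto
    moreover have "D * max_norm ?J ?v \<le> \<bar>D\<bar> * max_norm ?J ?v"
      using max_norm_ge_0[OF bdd] by (intro mult_right_mono) auto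
    moreover have "\<bar>D\<bar> * max_norm ?J ?v \<le> \<bar>D\<bar> * (\<bar>C\<bar> * \<bar>g \<Delta>x N\<bar>)"
      using le by (intro mult_left_mono max_norm_le) auto
    ultimately show ?case
      by simp
  qed
  then show ?thesis
    by (intro bigoI[of _ "\<bar>D\<bar> * \<bar>C\<bar>"]) (simp add: case_prod_unfold)
qed

section \<open>Distributing a bound over its summands\<close>

text \<open>
  With \<open>W\<close> the whole bound, the ratio \<open>v / W\<close> is bounded, and multiplying it by the individual
  summands of \<open>W\<close> gives the parts of \<open>v\<close>. The part \<open>B\<close> is defined as the difference, so that
  the identity holds at every point, also outside the region where the asymptotics apply.
\<close>

lemma bigo_weighted_sum_split:
  fixes v b :: "'p \<Rightarrow> real" and c a :: "'i \<Rightarrow> 'p \<Rightarrow> real"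
  assumes v: "v \<in> O[F](\<lambda>p. (\<Sum>i\<in>I. c i p * a i p) + b p)"
    and nonneg: "\<forall>\<^sub>F p in F. (\<forall>i\<in>I. 0 \<le> c i p \<and> 0 \<le> a i p) \<and> 0 \<le> b p"
  shows "\<exists>A B. (\<forall>i\<in>I. A i \<in> O[F](a i)) \<and> B \<in> O[F](b) \<and>
    (\<forall>p. v p = (\<Sum>i\<in>I. c i p * A i p) + B p)"
proof -
  define W where "W p = (\<Sum>i\<in>I. c i p * a i p) + b p" for p
  define r where "r p = v p / W p" for p
  define A where "A i p = r p * a i p" for i p
  define B where "B p = v p - (\<Sum>i\<in>I. c i p * A i p)" for p
  obtain C where "C > 0" and C: "\<forall>\<^sub>F p in F. norm (v p) \<le> C * norm (W p)"
    using landau_o.bigE[OF v] unfolding W_def by blast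
  have r_le: "\<forall>\<^sub>F p in F. \<bar>r p\<bar> \<le> C"
    using C
  proof eventually_elim
    case (elim p)
    then show ?case
      using \<open>C > 0\<close> by (cases "W p = 0") (simp_all add: r_def field_simps)
  qed
  have "A i \<in> O[F](a i)" for i
    unfolding A_def
    by (rule bigoI[of _ C], rule eventually_mono[OF r_le]) (simp add: abs_mult mult_right_mono)
  moreover have "B \<in> O[F](b)"
  proof (rule bigoI[of _ C])
    show "\<forall>\<^sub>F p in F. norm (B p) \<le> C * norm (b p)"
      using r_le C nonneg
    proof eventually_elim
      case (elim p)
      \<comment> \<open>Where \<open>W\<close> vanishes the bound forces \<open>v\<close> to vanish, which fits the value \<open>r = 0\<close> there.\<close>
      have "v p = r p * W p"
        using elim by (cases "W p = 0") (auto simp: r_def)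
      then have "B p = r p * b p"
        by (simp add: B_def A_def W_def distrib_left sum_distrib_left mult_ac)
      then show ?case
        using elim by (simp add: abs_mult mult_right_mono)
    qed
  qed
  moreover have "v p = (\<Sum>i\<in>I. c i p * A i p) + B p" for p
    by (simp add: B_def)
  ultimately show ?thesis
    by blast
qed

text \<open>
  Along a refinement process \<open>\<Delta>t\<close> stays at most \<open>T\<close>, so the powers of \<open>\<Delta>t\<close> in front of the spatial
  errors can be absorbed.
\<close>

lemma time_step_power_bigo_1:
  fixes R :: "(real \<times> nat) filter"
  assumes "T \<ge> 0" and R: "R \<le> at_right 0 \<times>\<^sub>F sequentially"
  shows "(\<lambda>(\<Delta>x, N). (T / real N) ^ k) \<in> O[R](\<lambda>_. 1)"
proof (rule bigoI[of _ "T ^ k"])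
  show "\<forall>\<^sub>F p in R. norm (case p of (\<Delta>x, N) \<Rightarrow> (T / real N) ^ k) \<le> T ^ k * norm (1 :: real)"
    using eventually_refined[OF R]
  proof eventually_elim
    case (elim p)
    obtain \<Delta>x N where [simp]: "p = (\<Delta>x, N)"
      by (cases p)
    have "T * 1 \<le> T * real N"
      using elim assms(1) by (intro mult_left_mono) auto
    then have "T / real N \<le> T"
      using elim by (simp add: divide_le_eq)
    then have "(T / real N) ^ k \<le> T ^ k"
      using assms(1) by (intro power_mono) auto
    then show ?case
      using assms(1) by simp
  qed
qed

section \<open>The global error\<close>

theorem theorem1:
  fixes F :: "real \<Rightarrow> real \<Rightarrow> real \<Rightarrow> real \<Rightarrow> real"
    and u :: "real \<Rightarrow> real \<Rightarrow> real"
    and \<Omega> :: "real set"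
    and T :: real
    and \<alpha> \<beta> :: nat
    and S :: scheme
    and \<nu> :: "real \<Rightarrow> (int \<Rightarrow> real) \<Rightarrow> real"
    and R :: "(real \<times> nat) filter"
  assumes "is_interval \<Omega>" and "interior \<Omega> \<noteq> {}"
    and "T > 0" and "\<alpha> \<ge> 1" and "\<beta> \<ge> 1"
    and "R \<le> at_right 0 \<times>\<^sub>F sequentially"
    and "smooth_solution F \<Omega> T u"
    and "taylor_expansion \<Omega> T R u"
    and "mol_scheme \<Omega> T R u \<alpha> \<beta> S"
    and "mesh_norm \<Omega> \<nu>"
  shows "(\<exists>A B.
            (\<forall>k<\<beta>. (\<lambda>(\<Delta>x, N). A k \<Delta>x N) \<in> O[R](\<lambda>(\<Delta>x, N). \<Delta>x ^ \<alpha>)) \<and>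
            (\<lambda>(\<Delta>x, N). B \<Delta>x N) \<in> O[R](\<lambda>(\<Delta>x, N). (T / real N) ^ \<beta>) \<and>
            (\<forall>\<Delta>x N. \<nu> \<Delta>x (global_error \<Omega> T u S \<Delta>x N)
                     = (\<Sum>k<\<beta>. (T / real N) ^ k * A k \<Delta>x N) + B \<Delta>x N)) \<and>
         (\<exists>A B.
            (\<lambda>(\<Delta>x, N). A \<Delta>x N) \<in> O[R](\<lambda>(\<Delta>x, N). \<Delta>x ^ \<alpha>) \<and>
            (\<lambda>(\<Delta>x, N). B \<Delta>x N) \<in> O[R](\<lambda>(\<Delta>x, N). (T / real N) ^ \<beta>) \<and>
            (\<forall>\<Delta>x N. \<nu> \<Delta>x (global_error \<Omega> T u S \<Delta>x N) = A \<Delta>x N + B \<Delta>x N))"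
proof -
  note T = \<open>T > 0\<close> and R = \<open>R \<le> at_right 0 \<times>\<^sub>F sequentially\<close>
  let ?v = "\<lambda>\<Delta>x N. \<nu> \<Delta>x (global_error \<Omega> T u S \<Delta>x N)"
  have "\<exists>C. \<forall>\<^sub>F (\<Delta>x, N) in R. \<forall>j\<in>mesh \<Omega> \<Delta>x.
      \<bar>global_error \<Omega> T u S \<Delta>x N j\<bar> \<le> C * \<bar>error_scale T \<alpha> \<beta> \<Delta>x N\<bar>"
    unfolding global_error_def
    using T local_error_bigo[OF T R \<open>taylor_expansion \<Omega> T R u\<close> \<open>mol_scheme \<Omega> T R u \<alpha> \<beta> S\<close>]
    by (intro sum_over_steps_bound) auto
  then have "(\<lambda>(\<Delta>x, N). ?v \<Delta>x N) \<in> O[R](\<lambda>(\<Delta>x, N). error_scale T \<alpha> \<beta> \<Delta>x N)"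
    by (rule mesh_norm_bigo[OF \<open>mesh_norm \<Omega> \<nu>\<close> R])
  then have bound: "(\<lambda>p. ?v (fst p) (snd p)) \<in>
      O[R](\<lambda>p. (\<Sum>k<\<beta>. (T / real (snd p)) ^ k * fst p ^ \<alpha>) + (T / real (snd p)) ^ \<beta>)"
    by (simp add: case_prod_unfold error_scale_def)
  have "\<forall>\<^sub>F p in R. (\<forall>k\<in>{..<\<beta>}. 0 \<le> (T / real (snd p)) ^ k \<and> 0 \<le> fst p ^ \<alpha>)
      \<and> 0 \<le> (T / real (snd p)) ^ \<beta>"
    by (rule eventually_mono[OF eventually_refined[OF R]]) (use T in auto)
  from bigo_weighted_sum_split[OF bound this] obtain A B where
    A: "\<forall>k\<in>{..<\<beta>}. A k \<in> O[R](\<lambda>p. fst p ^ \<alpha>)"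
    and B: "B \<in> O[R](\<lambda>p. (T / real (snd p)) ^ \<beta>)"
    and split: "\<And>p. ?v (fst p) (snd p) = (\<Sum>k<\<beta>. (T / real (snd p)) ^ k * A k p) + B p"
    by blast
  have split': "?v \<Delta>x N = (\<Sum>k<\<beta>. (T / real N) ^ k * A k (\<Delta>x, N)) + B (\<Delta>x, N)" for \<Delta>x N
    using split[of "(\<Delta>x, N)"] by simp
  have "(\<lambda>p. \<Sum>k<\<beta>. (T / real (snd p)) ^ k * A k p) \<in> O[R](\<lambda>p. fst p ^ \<alpha>)"
  proof (rule big_sum_in_bigo)
    fix k assume "k \<in> {..<\<beta>}"
    then have "A k \<in> O[R](\<lambda>p. fst p ^ \<alpha>)"
      using A by blast
    with time_step_power_bigo_1[OF less_imp_le[OF T] R, of k]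
    show "(\<lambda>p. (T / real (snd p)) ^ k * A k p) \<in> O[R](\<lambda>p. fst p ^ \<alpha>)"
      using landau_o.big.mult[of "\<lambda>p. (T / real (snd p)) ^ k" R "\<lambda>_. 1" "A k" "\<lambda>p. fst p ^ \<alpha>"]
      by (simp add: case_prod_unfold)
  qed
  then have short: "(\<lambda>(\<Delta>x, N). \<Sum>k<\<beta>. (T / real N) ^ k * A k (\<Delta>x, N)) \<in> O[R](\<lambda>(\<Delta>x, N). \<Delta>x ^ \<alpha>)"
    by (simp add: case_prod_unfold)
  have A': "\<forall>k<\<beta>. (\<lambda>(\<Delta>x, N). A k (\<Delta>x, N)) \<in> O[R](\<lambda>(\<Delta>x, N). \<Delta>x ^ \<alpha>)"
    using A by (simp add: case_prod_unfold)
  have B': "(\<lambda>(\<Delta>x, N). B (\<Delta>x, N)) \<in> O[R](\<lambda>(\<Delta>x, N). (T / real N) ^ \<beta>)"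
    using B by (simp add: case_prod_unfold)
  show ?thesis
  proof (rule conjI)
    show "\<exists>A B.
            (\<forall>k<\<beta>. (\<lambda>(\<Delta>x, N). A k \<Delta>x N) \<in> O[R](\<lambda>(\<Delta>x, N). \<Delta>x ^ \<alpha>)) \<and>
            (\<lambda>(\<Delta>x, N). B \<Delta>x N) \<in> O[R](\<lambda>(\<Delta>x, N). (T / real N) ^ \<beta>) \<and>
            (\<forall>\<Delta>x N. ?v \<Delta>x N = (\<Sum>k<\<beta>. (T / real N) ^ k * A k \<Delta>x N) + B \<Delta>x N)"
      by (rule exI[of _ "\<lambda>k \<Delta>x N. A k (\<Delta>x, N)"], rule exI[of _ "\<lambda>\<Delta>x N. B (\<Delta>x, N)"])
        (rule conjI[OF A' conjI[OF B']], intro allI split')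
    show "\<exists>A B.
            (\<lambda>(\<Delta>x, N). A \<Delta>x N) \<in> O[R](\<lambda>(\<Delta>x, N). \<Delta>x ^ \<alpha>) \<and>
            (\<lambda>(\<Delta>x, N). B \<Delta>x N) \<in> O[R](\<lambda>(\<Delta>x, N). (T / real N) ^ \<beta>) \<and>
            (\<forall>\<Delta>x N. ?v \<Delta>x N = A \<Delta>x N + B \<Delta>x N)"
      by (rule exI[of _ "\<lambda>\<Delta>x N. \<Sum>k<\<beta>. (T / real N) ^ k * A k (\<Delta>x, N)"],
          rule exI[of _ "\<lambda>\<Delta>x N. B (\<Delta>x, N)"])
        (rule conjI[OF short conjI[OF B']], intro allI split')
  qed
qed

end
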